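(* Let $\big((A\oplus A^*,[-,-]_d,\mathcal{B}_d),(A,[-,-]_A),(A^*,[-,-]_{A^*})\big)$ be a Manin triple of Lie algebras and let $(A,[-,-]_A,\delta)$ be the corresponding Lie bialgebra. Let $P,Q:A\to A$ be linear maps. Then $\big((A\oplus A^*,[-,-]_d,P+Q^*,\mathcal{B}_d),(A,[-,-]_A,P),(A^*,[-,-]_{A^*},Q^* )\big)$ is a Manin triple of averaging Lie algebras if and only if the following equations hold for all $x,y\in A$: $$[P(x),P(y)]_A=P([P(x),y]_A),\qquad [P(x),Q(y)]_A=Q([P(x),y]_A)=Q([x,Q(y)]_A),$$ $$(Q\otimes Q)\delta(x)=(Q\otimes\mathrm{id})\delta(Q(x)),\qquad (Q\otimes P)\delta(x)=(Q\otimes\mathrm{id})\delta(P(x))=(\mathrm{id}\otimes P)\delta(P(x)),$$ that is, $(A,[-,-]_A,\delta,P,Q)$ is an averaging Lie bialgebra.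
   Context: All vector spaces are finite-dimensional over an algebraically closed field $\mathbb{K}$ of characteristic zero. On $A\oplus A^*$ let $\mathcal{B}_d(x+a^*,y+b^* )=\langle x,b^*\rangle+\langle a^*,y\rangle$ for $x,y\in A$, $a^*,b^*\in A^*$. A Manin triple of Lie algebras $\big((A\oplus A^*,[-,-]_d,\mathcal{B}_d),(A,[-,-]_A),(A^*,[-,-]_{A^*})\big)$: a Lie algebra $(A\oplus A^*,[-,-]_d)$ containing the Lie algebras $(A,[-,-]_A)$ and $(A^*,[-,-]_{A^*})$ as Lie subalgebras such that $\mathcal{B}_d$ is invariant, i.e. $\mathcal{B}_d([u,v]_d,w)=\mathcal{B}_d(u,[v,w]_d)$. By a classical theorem, this is equivalent to $(A,[-,-]_A,\delta)$ being a Lie bialgebra (the corresponding Lie bialgebra), where $\delta:A\to A\otimes A$ is the linear dual of $[-,-]_{A^*}$: $\langle\delta(x),a^*\otimes b^*\rangle=\langle x,[a^*,b^*]_{A^*}\rangle$. A Lie bialgebra is a Lie algebra $(A,[-,-]_A)$ with a Lie coalgebra structure $\delta$ (i.e. $\delta=-\tau\delta$ with $\tau$ the flip, and $(\mathrm{id}+\sigma+\sigma^2)(\mathrm{id}\otimes\delta)\delta=0$ with $\sigma(x\otimes y\otimes z)=z\otimes x\otimes y$) such that $\delta([x,y]_A)=(\mathrm{ad}_A(x)\otimes\mathrm{id}+\mathrm{id}\otimes\mathrm{ad}_A(x))\delta(y)-(\mathrm{ad}_A(y)\otimes\mathrm{id}+\mathrm{id}\otimes\mathrm{ad}_A(y))\delta(x)$.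 An averaging operator on a Lie algebra $(\mathfrak{g},[-,-])$ is a linear map $R:\mathfrak{g}\to\mathfrak{g}$ with $[R(x),R(y)]=R([R(x),y])$ for all $x,y$. For a linear map $Q:A\to A$, $Q^*:A^*\to A^*$ is $\langle Q^*(a^* ),x\rangle=\langle a^*,Q(x)\rangle$, and $(P+Q^* )(x+a^* ):=P(x)+Q^*(a^* )$ on $A\oplus A^*$. A Manin triple of averaging Lie algebras $\big((A\oplus A^*,[-,-]_d,P+Q^*,\mathcal{B}_d),(A,[-,-]_A,P),(A^*,[-,-]_{A^*},Q^* )\big)$: a Manin triple of Lie algebras together with linear maps $P,Q$ such that $P$ is an averaging operator on $(A,[-,-]_A)$, $Q^*$ is an averaging operator on $(A^*,[-,-]_{A^*})$, and $P+Q^*$ is an averaging operator on $(A\oplus A^*,[-,-]_d)$. An averaging Lie bialgebra $(A,[-,-]_A,\delta,P,Q)$ is a Lie bialgebra $(A,[-,-]_A,\delta)$ with linear maps $P,Q:A\to A$ satisfying the displayed equations of the claim. *)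

theory Defs
  imports
    Complex_Main
    "HOL-Library.Function_Algebras"
    "HOL-Library.Product_Plus"
    "HOL-Library.Poly_Mapping"
    "HOL-Computational_Algebra.Polynomial"
begin

text \<open>
  A vector space \<open>A\<close> is a type with a scalar multiplication \<open>s\<close>. Its dual and the double
  \<open>A \<oplus> A*\<close> are subspaces of the types of all functions and of all pairs, so
  Lie algebras and operators are relativised to a carrier \<open>V\<close>.
\<close>

section \<open>Lie algebras and averaging operators\<close>

definition linear_on ::
  "('k::field \<Rightarrow> 'v::ab_group_add \<Rightarrow> 'v) \<Rightarrow> 'v set \<Rightarrow> ('v \<Rightarrow> 'v) \<Rightarrow> bool" where
  "linear_on s V f \<longleftrightarrow>
     (\<forall>x\<in>V. f x \<in> V) \<and>
     (\<forall>x\<in>V. \<forall>y\<in>V. f (x + y) = f x + f y) \<and>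
     (\<forall>c. \<forall>x\<in>V. f (s c x) = s c (f x))"

definition lie_algebra ::
  "('k::field \<Rightarrow> 'v::ab_group_add \<Rightarrow> 'v) \<Rightarrow> 'v set \<Rightarrow> ('v \<Rightarrow> 'v \<Rightarrow> 'v) \<Rightarrow> bool" where
  "lie_algebra s V br \<longleftrightarrow>
     vector_space s \<and> module.subspace s V \<and>
     (\<forall>x\<in>V. linear_on s V (\<lambda>y. br x y) \<and> linear_on s V (\<lambda>y. br y x)) \<and>
     (\<forall>x\<in>V. br x x = 0) \<and>
     (\<forall>x\<in>V. \<forall>y\<in>V. \<forall>z\<in>V. br x (br y z) + br y (br z x) + br z (br x y) = 0)"

definition averaging_operator ::
  "('k::field \<Rightarrow> 'v::ab_group_add \<Rightarrow> 'v) \<Rightarrow> 'v set \<Rightarrow> ('v \<Rightarrow> 'v \<Rightarrow> 'v) \<Rightarrow> ('v \<Rightarrow> 'v) \<Rightarrow> bool" where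
  "averaging_operator s V br R \<longleftrightarrow>
     linear_on s V R \<and> (\<forall>x\<in>V. \<forall>y\<in>V. br (R x) (R y) = R (br (R x) y))"


section \<open>The dual space and the double\<close>

definition dual :: "('k::field \<Rightarrow> 'a::ab_group_add \<Rightarrow> 'a) \<Rightarrow> ('a \<Rightarrow> 'k) set" where
  "dual s = {a. Vector_Spaces.linear s (*) a}"

definition dual_scale :: "'k::field \<Rightarrow> ('a \<Rightarrow> 'k) \<Rightarrow> 'a \<Rightarrow> 'k" where
  "dual_scale c a = (\<lambda>x. c * a x)"

definition dual_map :: "('a \<Rightarrow> 'a) \<Rightarrow> ('a \<Rightarrow> 'k) \<Rightarrow> 'a \<Rightarrow> 'k" where
  "dual_map Q a = (\<lambda>x. a (Q x))"

definition double :: "('k::field \<Rightarrow> 'a::ab_group_add \<Rightarrow> 'a) \<Rightarrow> ('a \<times> ('a \<Rightarrow> 'k)) set" where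
  "double s = UNIV \<times> dual s"

definition double_scale ::
  "('k::field \<Rightarrow> 'a \<Rightarrow> 'a) \<Rightarrow> 'k \<Rightarrow> 'a \<times> ('a \<Rightarrow> 'k) \<Rightarrow> 'a \<times> ('a \<Rightarrow> 'k)" where
  "double_scale s c u = (s c (fst u), dual_scale c (snd u))"

definition double_map ::
  "('a \<Rightarrow> 'a) \<Rightarrow> ('a \<Rightarrow> 'a) \<Rightarrow> 'a \<times> ('a \<Rightarrow> 'k) \<Rightarrow> 'a \<times> ('a \<Rightarrow> 'k)" where
  "double_map P Q u = (P (fst u), dual_map Q (snd u))"

definition Bd :: "'a \<times> ('a \<Rightarrow> 'k::field) \<Rightarrow> 'a \<times> ('a \<Rightarrow> 'k) \<Rightarrow> 'k" where
  "Bd u v = snd v (fst u) + snd u (fst v)"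


section \<open>Manin triples\<close>

text \<open>\<open>brd\<close>, \<open>brA\<close>, \<open>brD\<close> are the brackets on \<open>A \<oplus> A*\<close>, \<open>A\<close>, \<open>A*\<close>.\<close>

definition manin_triple ::
  "('k::field \<Rightarrow> 'a::ab_group_add \<Rightarrow> 'a) \<Rightarrow>
   ('a \<times> ('a \<Rightarrow> 'k) \<Rightarrow> 'a \<times> ('a \<Rightarrow> 'k) \<Rightarrow> 'a \<times> ('a \<Rightarrow> 'k)) \<Rightarrow>
   ('a \<Rightarrow> 'a \<Rightarrow> 'a) \<Rightarrow> (('a \<Rightarrow> 'k) \<Rightarrow> ('a \<Rightarrow> 'k) \<Rightarrow> 'a \<Rightarrow> 'k) \<Rightarrow> bool" where
  "manin_triple s brd brA brD \<longleftrightarrow>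
     lie_algebra (double_scale s) (double s) brd \<and>
     lie_algebra s UNIV brA \<and>
     lie_algebra dual_scale (dual s) brD \<and>
     (\<forall>x y. brd (x, 0) (y, 0) = (brA x y, 0)) \<and>
     (\<forall>a\<in>dual s. \<forall>b\<in>dual s. brd (0, a) (0, b) = (0, brD a b)) \<and>
     (\<forall>u\<in>double s. \<forall>v\<in>double s. \<forall>w\<in>double s. Bd (brd u v) w = Bd u (brd v w))"

definition averaging_manin_triple ::
  "('k::field \<Rightarrow> 'a::ab_group_add \<Rightarrow> 'a) \<Rightarrow>
   ('a \<times> ('a \<Rightarrow> 'k) \<Rightarrow> 'a \<times> ('a \<Rightarrow> 'k) \<Rightarrow> 'a \<times> ('a \<Rightarrow> 'k)) \<Rightarrow>
   ('a \<Rightarrow> 'a \<Rightarrow> 'a) \<Rightarrow> (('a \<Rightarrow> 'k) \<Rightarrow> ('a \<Rightarrow> 'k) \<Rightarrow> 'a \<Rightarrow> 'k) \<Rightarrow>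
   ('a \<Rightarrow> 'a) \<Rightarrow> ('a \<Rightarrow> 'a) \<Rightarrow> bool" where
  "averaging_manin_triple s brd brA brD P Q \<longleftrightarrow>
     manin_triple s brd brA brD \<and>
     Vector_Spaces.linear s s P \<and> Vector_Spaces.linear s s Q \<and>
     averaging_operator s UNIV brA P \<and>
     averaging_operator dual_scale (dual s) brD (dual_map Q) \<and>
     averaging_operator (double_scale s) (double s) brd (double_map P Q)"


section \<open>Tensor powers\<close>

text \<open>
  \<open>'i \<Rightarrow>\<^sub>0 'k\<close> is the free vector space on \<open>'i\<close>; \<open>A \<otimes> A\<close> and \<open>A \<otimes> A \<otimes> A\<close> are its quotients,
  for \<open>'i = 'a \<times> 'a\<close> and \<open>'i = 'a \<times> 'a \<times> 'a\<close>, by the multilinearity relations. The scalar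
  multiplication is a parameter, so these quotients are sets of cosets rather than types;
  operations on cosets are computed on an arbitrary representative.
\<close>

definition free_scale :: "'k::field \<Rightarrow> ('i \<Rightarrow>\<^sub>0 'k) \<Rightarrow> ('i \<Rightarrow>\<^sub>0 'k)" where
  "free_scale c f = Poly_Mapping.map ((*) c) f"

abbreviation gen :: "'i \<Rightarrow> ('i \<Rightarrow>\<^sub>0 'k::field)" where
  "gen i \<equiv> Poly_Mapping.single i 1"

text \<open>Linear extension of a map given on generators.\<close>

definition free_ext :: "('i \<Rightarrow> ('j \<Rightarrow>\<^sub>0 'k::field)) \<Rightarrow> ('i \<Rightarrow>\<^sub>0 'k) \<Rightarrow> ('j \<Rightarrow>\<^sub>0 'k)" where
  "free_ext F f = (\<Sum>i\<in>Poly_Mapping.keys f. free_scale (Poly_Mapping.lookup f i) (F i))"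

definition coset :: "('i \<Rightarrow>\<^sub>0 'k::field) set \<Rightarrow> ('i \<Rightarrow>\<^sub>0 'k) \<Rightarrow> ('i \<Rightarrow>\<^sub>0 'k) set" where
  "coset N f = {g. g - f \<in> N}"

definition rep :: "('i \<Rightarrow>\<^sub>0 'k::field) set \<Rightarrow> ('i \<Rightarrow>\<^sub>0 'k)" where
  "rep X = (SOME f. f \<in> X)"

definition coset_add ::
  "('i \<Rightarrow>\<^sub>0 'k::field) set \<Rightarrow> ('i \<Rightarrow>\<^sub>0 'k) set \<Rightarrow> ('i \<Rightarrow>\<^sub>0 'k) set \<Rightarrow> ('i \<Rightarrow>\<^sub>0 'k) set" where
  "coset_add N X Y = coset N (rep X + rep Y)"

definition coset_scale ::
  "('i \<Rightarrow>\<^sub>0 'k::field) set \<Rightarrow> 'k \<Rightarrow> ('i \<Rightarrow>\<^sub>0 'k) set \<Rightarrow> ('i \<Rightarrow>\<^sub>0 'k) set" where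
  "coset_scale N c X = coset N (free_scale c (rep X))"

definition rel2 :: "('k::field \<Rightarrow> 'a::ab_group_add \<Rightarrow> 'a) \<Rightarrow> ('a \<times> 'a \<Rightarrow>\<^sub>0 'k) set" where
  "rel2 s = module.span free_scale
     ({gen (x + x', y) - gen (x, y) - gen (x', y) | x x' y. True} \<union>
      {gen (x, y + y') - gen (x, y) - gen (x, y') | x y y'. True} \<union>
      {gen (s c x, y) - free_scale c (gen (x, y)) | c x y. True} \<union>
      {gen (x, s c y) - free_scale c (gen (x, y)) | c x y. True})"

definition rel3 :: "('k::field \<Rightarrow> 'a::ab_group_add \<Rightarrow> 'a) \<Rightarrow> ('a \<times> 'a \<times> 'a \<Rightarrow>\<^sub>0 'k) set" where
  "rel3 s = module.span free_scale
     ({gen (x + x', y, z) - gen (x, y, z) - gen (x', y, z) | x x' y z. True} \<union>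
      {gen (x, y + y', z) - gen (x, y, z) - gen (x, y', z) | x y y' z. True} \<union>
      {gen (x, y, z + z') - gen (x, y, z) - gen (x, y, z') | x y z z'. True} \<union>
      {gen (s c x, y, z) - free_scale c (gen (x, y, z)) | c x y z. True} \<union>
      {gen (x, s c y, z) - free_scale c (gen (x, y, z)) | c x y z. True} \<union>
      {gen (x, y, s c z) - free_scale c (gen (x, y, z)) | c x y z. True})"

definition tensor2 :: "('k::field \<Rightarrow> 'a::ab_group_add \<Rightarrow> 'a) \<Rightarrow> ('a \<times> 'a \<Rightarrow>\<^sub>0 'k) set set" where
  "tensor2 s = {coset (rel2 s) f | f. True}"

text \<open>\<open>P \<otimes> Q\<close> on \<open>A \<otimes> A\<close>.\<close>

definition tmap ::
  "('k::field \<Rightarrow> 'a::ab_group_add \<Rightarrow> 'a) \<Rightarrow> ('a \<Rightarrow> 'a) \<Rightarrow> ('a \<Rightarrow> 'a) \<Rightarrow>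
   ('a \<times> 'a \<Rightarrow>\<^sub>0 'k) set \<Rightarrow> ('a \<times> 'a \<Rightarrow>\<^sub>0 'k) set" where
  "tmap s P Q X = coset (rel2 s) (free_ext (\<lambda>(x, y). gen (P x, Q y)) (rep X))"

definition flip ::
  "('k::field \<Rightarrow> 'a::ab_group_add \<Rightarrow> 'a) \<Rightarrow> ('a \<times> 'a \<Rightarrow>\<^sub>0 'k) set \<Rightarrow> ('a \<times> 'a \<Rightarrow>\<^sub>0 'k) set" where
  "flip s X = coset (rel2 s) (free_ext (\<lambda>(x, y). gen (y, x)) (rep X))"

definition cyc ::
  "('k::field \<Rightarrow> 'a::ab_group_add \<Rightarrow> 'a) \<Rightarrow>
   ('a \<times> 'a \<times> 'a \<Rightarrow>\<^sub>0 'k) set \<Rightarrow> ('a \<times> 'a \<times> 'a \<Rightarrow>\<^sub>0 'k) set" where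
  "cyc s X = coset (rel3 s) (free_ext (\<lambda>(x, y, z). gen (z, x, y)) (rep X))"

text \<open>\<open>id \<otimes> \<delta> : A \<otimes> A \<rightarrow> A \<otimes> A \<otimes> A\<close>, for a linear \<open>\<delta> : A \<rightarrow> A \<otimes> A\<close>.\<close>

definition id_tensor ::
  "('k::field \<Rightarrow> 'a::ab_group_add \<Rightarrow> 'a) \<Rightarrow> ('a \<Rightarrow> ('a \<times> 'a \<Rightarrow>\<^sub>0 'k) set) \<Rightarrow>
   ('a \<times> 'a \<Rightarrow>\<^sub>0 'k) set \<Rightarrow> ('a \<times> 'a \<times> 'a \<Rightarrow>\<^sub>0 'k) set" where
  "id_tensor s \<delta> X = coset (rel3 s)
     (free_ext (\<lambda>(x, y). free_ext (\<lambda>(u, v). gen (x, u, v)) (rep (\<delta> y))) (rep X))"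

text \<open>The pairing \<open>\<langle>X, a \<otimes> b\<rangle>\<close> for \<open>X \<in> A \<otimes> A\<close> and \<open>a, b \<in> A*\<close>.\<close>

definition tpair :: "('a \<times> 'a \<Rightarrow>\<^sub>0 'k::field) set \<Rightarrow> ('a \<Rightarrow> 'k) \<Rightarrow> ('a \<Rightarrow> 'k) \<Rightarrow> 'k" where
  "tpair X a b = (\<Sum>(x, y)\<in>Poly_Mapping.keys (rep X). Poly_Mapping.lookup (rep X) (x, y) * (a x * b y))"


section \<open>Lie bialgebras\<close>

definition linear_to_tensor2 ::
  "('k::field \<Rightarrow> 'a::ab_group_add \<Rightarrow> 'a) \<Rightarrow> ('a \<Rightarrow> ('a \<times> 'a \<Rightarrow>\<^sub>0 'k) set) \<Rightarrow> bool" where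
  "linear_to_tensor2 s \<delta> \<longleftrightarrow>
     (\<forall>x. \<delta> x \<in> tensor2 s) \<and>
     (\<forall>x y. \<delta> (x + y) = coset_add (rel2 s) (\<delta> x) (\<delta> y)) \<and>
     (\<forall>c x. \<delta> (s c x) = coset_scale (rel2 s) c (\<delta> x))"

definition lie_coalgebra ::
  "('k::field \<Rightarrow> 'a::ab_group_add \<Rightarrow> 'a) \<Rightarrow> ('a \<Rightarrow> ('a \<times> 'a \<Rightarrow>\<^sub>0 'k) set) \<Rightarrow> bool" where
  "lie_coalgebra s \<delta> \<longleftrightarrow>
     linear_to_tensor2 s \<delta> \<and>
     (\<forall>x. \<delta> x = coset_scale (rel2 s) (-1) (flip s (\<delta> x))) \<and>
     (\<forall>x. let X = id_tensor s \<delta> (\<delta> x) in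
        coset_add (rel3 s) (coset_add (rel3 s) X (cyc s X)) (cyc s (cyc s X)) = coset (rel3 s) 0)"

text \<open>\<open>(ad(x) \<otimes> id + id \<otimes> ad(x)) X\<close>\<close>

definition ad2 ::
  "('k::field \<Rightarrow> 'a::ab_group_add \<Rightarrow> 'a) \<Rightarrow> ('a \<Rightarrow> 'a \<Rightarrow> 'a) \<Rightarrow> 'a \<Rightarrow>
   ('a \<times> 'a \<Rightarrow>\<^sub>0 'k) set \<Rightarrow> ('a \<times> 'a \<Rightarrow>\<^sub>0 'k) set" where
  "ad2 s br x X = coset_add (rel2 s) (tmap s (br x) id X) (tmap s id (br x) X)"

definition lie_bialgebra ::
  "('k::field \<Rightarrow> 'a::ab_group_add \<Rightarrow> 'a) \<Rightarrow> ('a \<Rightarrow> 'a \<Rightarrow> 'a) \<Rightarrow>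
   ('a \<Rightarrow> ('a \<times> 'a \<Rightarrow>\<^sub>0 'k) set) \<Rightarrow> bool" where
  "lie_bialgebra s br \<delta> \<longleftrightarrow>
     lie_algebra s UNIV br \<and> lie_coalgebra s \<delta> \<and>
     (\<forall>x y. \<delta> (br x y) =
        coset_add (rel2 s) (ad2 s br x (\<delta> y)) (coset_scale (rel2 s) (-1) (ad2 s br y (\<delta> x))))"

text \<open>\<open>\<delta> : A \<rightarrow> A \<otimes> A\<close> is the linear dual of the bracket \<open>brD\<close> on \<open>A*\<close>; in finite
  dimension this determines \<open>\<delta>\<close> uniquely.\<close>

definition dual_cobracket ::
  "('k::field \<Rightarrow> 'a::ab_group_add \<Rightarrow> 'a) \<Rightarrow> (('a \<Rightarrow> 'k) \<Rightarrow> ('a \<Rightarrow> 'k) \<Rightarrow> 'a \<Rightarrow> 'k) \<Rightarrow>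
   ('a \<Rightarrow> ('a \<times> 'a \<Rightarrow>\<^sub>0 'k) set) \<Rightarrow> bool" where
  "dual_cobracket s brD \<delta> \<longleftrightarrow>
     (\<forall>x. \<delta> x \<in> tensor2 s) \<and>
     (\<forall>x. \<forall>a\<in>dual s. \<forall>b\<in>dual s. tpair (\<delta> x) a b = brD a b x)"

definition averaging_lie_bialgebra ::
  "('k::field \<Rightarrow> 'a::ab_group_add \<Rightarrow> 'a) \<Rightarrow> ('a \<Rightarrow> 'a \<Rightarrow> 'a) \<Rightarrow>
   ('a \<Rightarrow> ('a \<times> 'a \<Rightarrow>\<^sub>0 'k) set) \<Rightarrow> ('a \<Rightarrow> 'a) \<Rightarrow> ('a \<Rightarrow> 'a) \<Rightarrow> bool" where
  "averaging_lie_bialgebra s br \<delta> P Q \<longleftrightarrow>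
     lie_bialgebra s br \<delta> \<and>
     Vector_Spaces.linear s s P \<and> Vector_Spaces.linear s s Q \<and>
     (\<forall>x y. br (P x) (P y) = P (br (P x) y)) \<and>
     (\<forall>x y. br (P x) (Q y) = Q (br (P x) y) \<and> Q (br (P x) y) = Q (br x (Q y))) \<and>
     (\<forall>x. tmap s Q Q (\<delta> x) = tmap s Q id (\<delta> (Q x))) \<and>
     (\<forall>x. tmap s Q P (\<delta> x) = tmap s Q id (\<delta> (P x)) \<and>
          tmap s Q id (\<delta> (P x)) = tmap s id P (\<delta> (P x)))"

end

theory Submission
  imports Defs
begin

text \<open>
  In finite dimension a tensor is determined by its pairings with products of linear forms, so every
  identity in \<open>A \<otimes> A\<close> or \<open>A \<otimes> A \<otimes> A\<close> that involves \<open>\<delta>\<close> becomes an identity for the bracket of \<open>A*\<close>.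
  By invariance of the form, the mixed bracket is
  \<open>[x, b] = (u, - b \<circ> ad x)\<close>, where \<open>u\<close> is given by \<open>a(u) = [b, a](x)\<close> for all \<open>a \<in> A*\<close>.
  Pairing the Jacobi identity for \<open>x, y, a\<close> with \<open>b\<close> gives the cocycle condition, and the Jacobi
  identity of \<open>A*\<close> gives co-Jacobi. The averaging identity on the double splits into the cases
  \<open>(x, y)\<close>, \<open>(a, b)\<close>, \<open>(x, b)\<close>, \<open>(a, y)\<close>; the last two each have a component in \<open>A\<close> and
  one in \<open>A*\<close>, which gives the six equations.
\<close>

section \<open>Linear functionals on free vector spaces\<close>

definition free_eval :: "('i \<Rightarrow> 'k::field) \<Rightarrow> ('i \<Rightarrow>\<^sub>0 'k) \<Rightarrow> 'k" where
  "free_eval F f = (\<Sum>i\<in>Poly_Mapping.keys f. Poly_Mapping.lookup f i * F i)"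

lemma lookup_free_scale [simp]:
  "Poly_Mapping.lookup (free_scale c f) i = c * Poly_Mapping.lookup f i"
  by (simp add: free_scale_def map.rep_eq when_def)

lemma lookup_sum_free:
  "Poly_Mapping.lookup (sum g A) i = (\<Sum>x\<in>A. Poly_Mapping.lookup (g x) i)"
  by (induction A rule: infinite_finite_induct) (simp_all add: lookup_add)

interpretation free: vector_space "free_scale :: 'k::field \<Rightarrow> ('i \<Rightarrow>\<^sub>0 'k) \<Rightarrow> ('i \<Rightarrow>\<^sub>0 'k)"
  by unfold_locales (auto intro!: poly_mapping_eqI simp: lookup_add algebra_simps)

text \<open>Supports of \<open>f\<close>, \<open>g\<close> and \<open>f + g\<close> differ;
  enlarging each to one common finite set makes the sums comparable term by term.\<close>

lemma free_eval_superset: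
  assumes "finite K" "Poly_Mapping.keys f \<subseteq> K"
  shows "free_eval F f = (\<Sum>i\<in>K. Poly_Mapping.lookup f i * F i)"
  unfolding free_eval_def using assms by (intro sum.mono_neutral_left) (auto simp: in_keys_iff)

lemma free_eval_add: "free_eval F (f + g) = free_eval F f + free_eval F g"
proof -
  let ?K = "Poly_Mapping.keys f \<union> Poly_Mapping.keys g"
  have "free_eval F h = (\<Sum>i\<in>?K. Poly_Mapping.lookup h i * F i)" if "h \<in> {f, g, f + g}" for h
    using that keys_add[of f g] by (intro free_eval_superset) auto
  then show ?thesis by (simp add: lookup_add distrib_right sum.distrib)
qed

lemma free_eval_scale: "free_eval F (free_scale c f) = c * free_eval F f"
proof -
  have "free_eval F (free_scale c f)
      = (\<Sum>i\<in>Poly_Mapping.keys f. Poly_Mapping.lookup (free_scale c f) i * F i)"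
    by (intro free_eval_superset) (auto simp: in_keys_iff)
  then show ?thesis by (simp add: free_eval_def sum_distrib_left mult.assoc)
qed

lemma free_eval_zero [simp]: "free_eval F 0 = 0"
  by (simp add: free_eval_def)

lemma free_eval_diff: "free_eval F (f - g) = free_eval F f - free_eval F g"
  using free_eval_add[of F "f - g" g] by simp

lemma free_eval_sum: "free_eval F (sum g A) = (\<Sum>x\<in>A. free_eval F (g x))"
  by (induction A rule: infinite_finite_induct) (simp_all add: free_eval_add)

lemma free_eval_gen [simp]: "free_eval F (gen i) = F i"
  by (simp add: free_eval_def)

text \<open>Applying a functional after a linear extension amounts to pulling it back along the
  generators. This is how every map on tensors defined by \<open>free_ext\<close> is later moved
  onto the linear forms.\<close>

lemma free_eval_free_ext: "free_eval G (free_ext F f) = free_eval (\<lambda>i. free_eval G (F i)) f"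
  by (simp add: free_ext_def free_eval_sum free_eval_scale free_eval_def[of _ f])

lemma lookup_free_ext:
  "Poly_Mapping.lookup (free_ext F f) j = free_eval (\<lambda>i. Poly_Mapping.lookup (F i) j) f"
  by (simp add: free_ext_def lookup_sum_free free_eval_def)

lemma free_ext_gen: "free_ext gen f = f"
  by (rule poly_mapping_eqI)
    (simp add: lookup_free_ext free_eval_def lookup_single when_def in_keys_iff
      if_distrib[of "(*) _"] cong: if_cong)

text \<open>Since \<open>f\<close> is its own expansion in generators, the difference is a linear
  combination of the elements \<open>gen i - G i\<close>.\<close>

lemma free_ext_congruent:
  assumes "free.subspace W" "\<And>i. gen i - G i \<in> W"
  shows "f - free_ext G f \<in> W"
proof -
  have "f - free_ext G f = free_ext gen f - free_ext G f"
    by (simp add: free_ext_gen)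
  also have "\<dots> = (\<Sum>i\<in>Poly_Mapping.keys f. free_scale (Poly_Mapping.lookup f i) (gen i - G i))"
    by (simp add: free_ext_def free.scale_right_diff_distrib sum_subtractf)
  finally show ?thesis
    using assms by (auto intro!: free.subspace_sum free.subspace_scale)
qed

section \<open>Cosets and their representatives\<close>

lemma coset_eq_iff:
  assumes "free.subspace W"
  shows "coset W f = coset W g \<longleftrightarrow> f - g \<in> W"
proof
  assume "coset W f = coset W g"
  moreover have "f \<in> coset W f"
    using free.subspace_0[OF assms] by (simp add: coset_def)
  ultimately show "f - g \<in> W" by (simp add: coset_def)
next
  assume fg: "f - g \<in> W"
  have "h - f \<in> W \<longleftrightarrow> h - g \<in> W" for h
    using free.subspace_add[OF assms _ fg, of "h - f"] free.subspace_diff[OF assms _ fg, of "h - g"]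
    by auto
  then show "coset W f = coset W g" by (simp add: coset_def)
qed

lemma rep_coset:
  assumes "free.subspace W"
  shows "rep (coset W f) - f \<in> W"
proof -
  have "f \<in> coset W f"
    using free.subspace_0[OF assms] by (simp add: coset_def)
  then have "rep (coset W f) \<in> coset W f"
    unfolding rep_def by (rule someI)
  then show ?thesis by (simp add: coset_def)
qed

section \<open>Products of linear forms on tensors\<close>

definition pair2 :: "('a \<Rightarrow> 'k::field) \<Rightarrow> ('a \<Rightarrow> 'k) \<Rightarrow> 'a \<times> 'a \<Rightarrow> 'k" where
  "pair2 a b = (\<lambda>(x, y). a x * b y)"

definition pair3 ::
  "('a \<Rightarrow> 'k::field) \<Rightarrow> ('a \<Rightarrow> 'k) \<Rightarrow> ('a \<Rightarrow> 'k) \<Rightarrow> 'a \<times> 'a \<times> 'a \<Rightarrow> 'k" where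
  "pair3 a b c = (\<lambda>(x, y, z). a x * b y * c z)"

definition tpair3 ::
  "('a \<times> 'a \<times> 'a \<Rightarrow>\<^sub>0 'k::field) set \<Rightarrow> ('a \<Rightarrow> 'k) \<Rightarrow> ('a \<Rightarrow> 'k) \<Rightarrow> ('a \<Rightarrow> 'k) \<Rightarrow> 'k" where
  "tpair3 X a b c = free_eval (pair3 a b c) (rep X)"

lemma tpair_eq_free_eval: "tpair X a b = free_eval (pair2 a b) (rep X)"
  by (simp add: tpair_def free_eval_def pair2_def split_beta)

lemma subspace_rel2: "free.subspace (rel2 s)"
  unfolding rel2_def by (rule free.subspace_span)

lemma subspace_rel3: "free.subspace (rel3 s)"
  unfolding rel3_def by (rule free.subspace_span)

lemma subspace_free_eval_kernel: "free.subspace {f. free_eval F f = 0}"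
  by (auto simp: free.subspace_def free_eval_add free_eval_scale)

lemma dualD:
  assumes "a \<in> dual s"
  shows dual_add: "a (x + y) = a x + a y" and dual_scale_arg: "a (s c x) = c * a x"
    and dual_zero: "a 0 = 0" and dual_diff: "a (x - y) = a x - a y"
proof -
  interpret Vector_Spaces.linear s "(*)" a using assms by (simp add: dual_def)
  show "a (x + y) = a x + a y" "a (s c x) = c * a x" "a 0 = 0" "a (x - y) = a x - a y"
    by (fact add scale zero diff)+
qed

lemma dualI:
  assumes "vector_space s" "\<And>x y. a (x + y) = a x + a y" "\<And>c x. a (s c x) = c * a x"
  shows "a \<in> dual s"
proof -
  interpret vector_space s by fact
  show ?thesis unfolding dual_def mem_Collect_eq
    by unfold_locales (auto simp: assms algebra_simps)
qed

text \<open>A product of linear forms is bilinear, hence kills each generating relation, and its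
  kernel is a subspace, hence contains their span. This makes the pairing independent of the
  representative.\<close>

lemma free_eval_rel2:
  assumes "f \<in> rel2 s" and "a \<in> dual s" "b \<in> dual s"
  shows "free_eval (pair2 a b) f = 0"
  using assms(1) unfolding rel2_def
proof (induction rule: free.span_induct)
  case base
  show ?case by (rule subspace_free_eval_kernel)
next
  case (step f)
  then show ?case
    by (elim UnE CollectE exE conjE; hypsubst; simp (no_asm) add: free_eval_add free_eval_diff free_eval_scale pair2_def dualD[OF assms(2)] dualD[OF assms(3)]
        algebra_simps)
qed

lemma free_eval_rel3:
  assumes "f \<in> rel3 s" and "a \<in> dual s" "b \<in> dual s" "c \<in> dual s"
  shows "free_eval (pair3 a b c) f = 0"
  using assms(1) unfolding rel3_def
proof (induction rule: free.span_induct)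
  case base
  show ?case by (rule subspace_free_eval_kernel)
next
  case (step f)
  then show ?case
    by (elim UnE CollectE exE conjE; hypsubst; simp (no_asm) add: free_eval_add free_eval_diff free_eval_scale pair3_def dualD[OF assms(2)] dualD[OF assms(3)]
        dualD[OF assms(4)] algebra_simps)
qed

lemma rel2_gens:
  shows "gen (x + x', y) - gen (x, y) - gen (x', y) \<in> rel2 s"
    and "gen (x, y + y') - gen (x, y) - gen (x, y') \<in> rel2 s"
    and "gen (s c x, y) - free_scale c (gen (x, y)) \<in> rel2 s"
    and "gen (x, s c y) - free_scale c (gen (x, y)) \<in> rel2 s"
  unfolding rel2_def
  subgoal by (rule free.span_base, rule UnI1, rule UnI1, rule UnI1, intro CollectI exI conjI, rule refl, rule TrueI)
  subgoal by (rule free.span_base, rule UnI1, rule UnI1, rule UnI2, intro CollectI exI conjI, rule refl, rule TrueI)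
  subgoal by (rule free.span_base, rule UnI1, rule UnI2, intro CollectI exI conjI, rule refl, rule TrueI)
  subgoal by (rule free.span_base, rule UnI2, intro CollectI exI conjI, rule refl, rule TrueI)
  done

lemma rel3_gens:
  shows "gen (x + x', y, z) - gen (x, y, z) - gen (x', y, z) \<in> rel3 s"
    and "gen (x, y + y', z) - gen (x, y, z) - gen (x, y', z) \<in> rel3 s"
    and "gen (x, y, z + z') - gen (x, y, z) - gen (x, y, z') \<in> rel3 s"
    and "gen (s c x, y, z) - free_scale c (gen (x, y, z)) \<in> rel3 s"
    and "gen (x, s c y, z) - free_scale c (gen (x, y, z)) \<in> rel3 s"
    and "gen (x, y, s c z) - free_scale c (gen (x, y, z)) \<in> rel3 s"
  unfolding rel3_def
  subgoal by (rule free.span_base, rule UnI1, rule UnI1, rule UnI1, rule UnI1, rule UnI1, intro CollectI exI conjI, rule refl, rule TrueI)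
  subgoal by (rule free.span_base, rule UnI1, rule UnI1, rule UnI1, rule UnI1, rule UnI2, intro CollectI exI conjI, rule refl, rule TrueI)
  subgoal by (rule free.span_base, rule UnI1, rule UnI1, rule UnI1, rule UnI2, intro CollectI exI conjI, rule refl, rule TrueI)
  subgoal by (rule free.span_base, rule UnI1, rule UnI1, rule UnI2, intro CollectI exI conjI, rule refl, rule TrueI)
  subgoal by (rule free.span_base, rule UnI1, rule UnI2, intro CollectI exI conjI, rule refl, rule TrueI)
  subgoal by (rule free.span_base, rule UnI2, intro CollectI exI conjI, rule refl, rule TrueI)
  done

text \<open>In the iterated sums below the innermost index belongs to the last slot. Its test must
  come outermost for \<open>sum.delta\<close> to collapse that sum first.\<close>

lemma if_conj_swap:
  "(if P \<and> Q then x else y) = (if Q then if P then x else y else y)"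
  by simp

section \<open>Linear forms separate tensors in finite dimension\<close>

context finite_dimensional_vector_space
begin

abbreviation coord :: "'b \<Rightarrow> 'b \<Rightarrow> 'a" where
  "coord e \<equiv> (\<lambda>x. representation Basis x e)"

lemma coord_in_dual: "coord e \<in> dual scale"
  unfolding dual_def mem_Collect_eq
  by (rule linear_representation[OF independent_Basis span_Basis])

lemma coord_expansion: "(\<Sum>e\<in>Basis. scale (coord e x) e) = x"
  by (rule sum_representation_eq[OF independent_Basis _ finite_Basis]) (simp_all add: span_Basis)

lemma dual_separates:
  assumes "\<And>a. a \<in> dual scale \<Longrightarrow> a x = a y"
  shows "x = y"
proof -
  have "(\<Sum>e\<in>Basis. scale (coord e x) e) = (\<Sum>e\<in>Basis. scale (coord e y) e)"
    by (simp only: assms[OF coord_in_dual])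
  then show ?thesis by (simp only: coord_expansion)
qed

text \<open>Here \<open>\<phi>\<close> is linear only modulo \<open>W\<close>, so the expansion of
  \<open>x\<close> in the basis passes through \<open>\<phi>\<close> up to an element of
  \<open>W\<close>. It serves to expand one slot of a generator at a time.\<close>

lemma congruent_basis_expansion:
  assumes W: "free.subspace W"
    and add: "\<And>x y. \<phi> (x + y) - \<phi> x - \<phi> y \<in> W"
    and scl: "\<And>c x. \<phi> (scale c x) - free_scale c (\<phi> x) \<in> W"
  shows "\<phi> x - (\<Sum>e\<in>Basis. free_scale (coord e x) (\<phi> e)) \<in> W"
proof -
  have "\<phi> (\<Sum>e\<in>T. scale (coord e x) e) - (\<Sum>e\<in>T. free_scale (coord e x) (\<phi> e)) \<in> W"
    if "finite T" for T
    using that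
  proof (induction T rule: finite_induct)
    case empty
    \<comment> \<open>The scalar 0 turns homogeneity into the membership of \<open>\<phi> 0\<close>
      in \<open>W\<close>.\<close>
    then show ?case using scl[of 0 0] by simp
  next
    case (insert e T)
    let ?r = "scale (coord e x) e" and ?t = "\<Sum>e\<in>T. scale (coord e x) e"
    have "(\<phi> (?r + ?t) - \<phi> ?r - \<phi> ?t) + (\<phi> ?r - free_scale (coord e x) (\<phi> e))
        + (\<phi> ?t - (\<Sum>e\<in>T. free_scale (coord e x) (\<phi> e))) \<in> W"
      by (intro free.subspace_add[OF W] add scl insert.IH)
    then show ?case using insert.hyps by (simp add: algebra_simps)
  qed
  from this[OF finite_Basis] show ?thesis by (simp add: coord_expansion)
qed

text \<open>For the converse, every generator is congruent to a combination \<open>G\<close> of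
  generators on basis pairs. So \<open>f\<close> is congruent to \<open>free_ext G f\<close>, whose
  coefficients are values on \<open>f\<close> of products of coordinate forms, and these vanish by
  assumption.\<close>

lemma rel2_iff:
  "f \<in> rel2 scale \<longleftrightarrow> (\<forall>a\<in>dual scale. \<forall>b\<in>dual scale. free_eval (pair2 a b) f = 0)"
proof (intro iffI ballI)
  assume vanish: "\<forall>a\<in>dual scale. \<forall>b\<in>dual scale. free_eval (pair2 a b) f = 0"
  define G :: "'b \<times> 'b \<Rightarrow> ('b \<times> 'b \<Rightarrow>\<^sub>0 'a)" where
    "G = (\<lambda>(x, y). \<Sum>e\<in>Basis. free_scale (coord e x) (\<Sum>e'\<in>Basis. free_scale (coord e' y) (gen (e, e'))))"
  note W = subspace_rel2[of scale]
  have "gen (x, y) - G (x, y) \<in> rel2 scale" for x y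
  proof -
    let ?g = "\<lambda>e. \<Sum>e'\<in>Basis. free_scale (coord e' y) (gen (e, e'))"
    have "gen (x, y) - (\<Sum>e\<in>Basis. free_scale (coord e x) (gen (e, y))) \<in> rel2 scale"
      by (rule congruent_basis_expansion[where \<phi> = "\<lambda>x. gen (x, y)"]) (rule W rel2_gens)+
    moreover have "gen (e, y) - ?g e \<in> rel2 scale" for e
      by (rule congruent_basis_expansion[where \<phi> = "\<lambda>y. gen (e, y)"]) (rule W rel2_gens)+
    then have "(\<Sum>e\<in>Basis. free_scale (coord e x) (gen (e, y) - ?g e)) \<in> rel2 scale"
      by (intro free.subspace_sum free.subspace_scale W)
    ultimately show ?thesis
      using free.subspace_add[OF W]
      by (fastforce simp: G_def free.scale_right_diff_distrib sum_subtractf)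
  qed
  then have "f - free_ext G f \<in> rel2 scale"
    by (intro free_ext_congruent W) auto
  moreover have "free_ext G f = 0"
  proof (rule poly_mapping_eqI)
    fix j :: "'b \<times> 'b"
    obtain p q where j: "j = (p, q)" by force
    \<comment> \<open>As a function of the generator, the coefficient at \<open>(p, q)\<close> is
      the product of two coordinate forms, or zero if \<open>p\<close> or \<open>q\<close> lies
      outside the basis.\<close>
    have "(\<lambda>i. Poly_Mapping.lookup (G i) j)
        = (if p \<in> Basis \<and> q \<in> Basis then pair2 (coord p) (coord q) else (\<lambda>_. 0))"
      using finite_Basis
      by (auto simp: fun_eq_iff G_def pair2_def j lookup_sum_free lookup_single when_def
          sum.delta sum_distrib_left if_distrib[of "(*) _"] if_conj_swap split: if_splits cong: if_cong
          intro!: sum.neutral)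
    then show "Poly_Mapping.lookup (free_ext G f) j = Poly_Mapping.lookup 0 j"
      using vanish coord_in_dual by (simp add: lookup_free_ext free_eval_def[of "\<lambda>_. 0"])
  qed
  ultimately show "f \<in> rel2 scale" by simp
qed (rule free_eval_rel2)

text \<open>The argument for two factors with one more expansion: \<open>H\<close> expands the last
  slot, \<open>K\<close> the last two, and \<open>G\<close> all three.\<close>

lemma rel3_iff:
  "f \<in> rel3 scale \<longleftrightarrow>
    (\<forall>a\<in>dual scale. \<forall>b\<in>dual scale. \<forall>c\<in>dual scale. free_eval (pair3 a b c) f = 0)"
proof (intro iffI ballI)
  assume vanish: "\<forall>a\<in>dual scale. \<forall>b\<in>dual scale. \<forall>c\<in>dual scale. free_eval (pair3 a b c) f = 0"
  define H :: "'b \<Rightarrow> 'b \<Rightarrow> 'b \<Rightarrow> ('b \<times> 'b \<times> 'b \<Rightarrow>\<^sub>0 'a)" where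
    "H = (\<lambda>e e' z. \<Sum>e''\<in>Basis. free_scale (coord e'' z) (gen (e, e', e'')))"
  define K :: "'b \<Rightarrow> 'b \<Rightarrow> 'b \<Rightarrow> ('b \<times> 'b \<times> 'b \<Rightarrow>\<^sub>0 'a)" where
    "K = (\<lambda>e y z. \<Sum>e'\<in>Basis. free_scale (coord e' y) (H e e' z))"
  define G :: "'b \<times> 'b \<times> 'b \<Rightarrow> ('b \<times> 'b \<times> 'b \<Rightarrow>\<^sub>0 'a)" where
    "G = (\<lambda>(x, y, z). \<Sum>e\<in>Basis. free_scale (coord e x) (K e y z))"
  note W = subspace_rel3[of scale]
  have H: "gen (e, e', z) - H e e' z \<in> rel3 scale" for e e' z
    unfolding H_def
    by (rule congruent_basis_expansion[where \<phi> = "\<lambda>z. gen (e, e', z)"]) (rule W rel3_gens)+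
  have K: "gen (e, y, z) - K e y z \<in> rel3 scale" for e y z
  proof -
    have "gen (e, y, z) - (\<Sum>e'\<in>Basis. free_scale (coord e' y) (gen (e, e', z))) \<in> rel3 scale"
      by (rule congruent_basis_expansion[where \<phi> = "\<lambda>y. gen (e, y, z)"]) (rule W rel3_gens)+
    moreover have "(\<Sum>e'\<in>Basis. free_scale (coord e' y) (gen (e, e', z) - H e e' z)) \<in> rel3 scale"
      by (intro free.subspace_sum free.subspace_scale W H)
    ultimately show ?thesis
      using free.subspace_add[OF W]
      by (fastforce simp: K_def free.scale_right_diff_distrib sum_subtractf)
  qed
  have "gen (x, y, z) - G (x, y, z) \<in> rel3 scale" for x y z
  proof -
    have "gen (x, y, z) - (\<Sum>e\<in>Basis. free_scale (coord e x) (gen (e, y, z))) \<in> rel3 scale"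
      by (rule congruent_basis_expansion[where \<phi> = "\<lambda>x. gen (x, y, z)"]) (rule W rel3_gens)+
    moreover have "(\<Sum>e\<in>Basis. free_scale (coord e x) (gen (e, y, z) - K e y z)) \<in> rel3 scale"
      by (intro free.subspace_sum free.subspace_scale W K)
    ultimately show ?thesis
      using free.subspace_add[OF W]
      by (fastforce simp: G_def free.scale_right_diff_distrib sum_subtractf)
  qed
  then have "f - free_ext G f \<in> rel3 scale"
    by (intro free_ext_congruent W) auto
  moreover have "free_ext G f = 0"
  proof (rule poly_mapping_eqI)
    fix j :: "'b \<times> 'b \<times> 'b"
    obtain p q r where j: "j = (p, q, r)" using prod_cases3 by blast
    have "(\<lambda>i. Poly_Mapping.lookup (G i) j)
        = (if p \<in> Basis \<and> q \<in> Basis \<and> r \<in> Basis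
           then pair3 (coord p) (coord q) (coord r) else (\<lambda>_. 0))"
      using finite_Basis
      by (auto simp: fun_eq_iff G_def K_def H_def pair3_def j lookup_sum_free lookup_single when_def
          sum.delta sum_distrib_left if_distrib[of "(*) _"] if_conj_swap split: if_splits cong: if_cong
          intro!: sum.neutral)
    then show "Poly_Mapping.lookup (free_ext G f) j = Poly_Mapping.lookup 0 j"
      using vanish coord_in_dual by (simp add: lookup_free_ext free_eval_def[of "\<lambda>_. 0"])
  qed
  ultimately show "f \<in> rel3 scale" by simp
qed (rule free_eval_rel3)

section \<open>Transposing tensor operations to linear forms\<close>

lemma coset_rel2_eq_iff:
  "coset (rel2 scale) f = coset (rel2 scale) g \<longleftrightarrow>
    (\<forall>a\<in>dual scale. \<forall>b\<in>dual scale. free_eval (pair2 a b) f = free_eval (pair2 a b) g)"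
  by (simp add: coset_eq_iff[OF subspace_rel2] rel2_iff free_eval_diff)

lemma coset_rel3_eq_iff:
  "coset (rel3 scale) f = coset (rel3 scale) g \<longleftrightarrow>
    (\<forall>a\<in>dual scale. \<forall>b\<in>dual scale. \<forall>c\<in>dual scale.
      free_eval (pair3 a b c) f = free_eval (pair3 a b c) g)"
  by (simp add: coset_eq_iff[OF subspace_rel3] rel3_iff free_eval_diff)

lemma tpair_coset:
  "a \<in> dual scale \<Longrightarrow> b \<in> dual scale \<Longrightarrow>
    tpair (coset (rel2 scale) f) a b = free_eval (pair2 a b) f"
  using free_eval_rel2[OF rep_coset[OF subspace_rel2]]
  by (fastforce simp: tpair_eq_free_eval free_eval_diff)

lemma tpair3_coset:
  "a \<in> dual scale \<Longrightarrow> b \<in> dual scale \<Longrightarrow> c \<in> dual scale \<Longrightarrow>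
    tpair3 (coset (rel3 scale) f) a b c = free_eval (pair3 a b c) f"
  using free_eval_rel3[OF rep_coset[OF subspace_rel3]]
  by (fastforce simp: tpair3_def free_eval_diff)

lemma tensor2_eqI:
  assumes "X \<in> tensor2 scale" "Y \<in> tensor2 scale"
    and "\<And>a b. a \<in> dual scale \<Longrightarrow> b \<in> dual scale \<Longrightarrow> tpair X a b = tpair Y a b"
  shows "X = Y"
proof -
  obtain f g where "X = coset (rel2 scale) f" "Y = coset (rel2 scale) g"
    using assms(1,2) by (auto simp: tensor2_def)
  then show ?thesis using assms(3) by (simp add: coset_rel2_eq_iff tpair_coset)
qed

lemma tensor2_intros [simp]:
  "coset (rel2 scale) f \<in> tensor2 scale" "tmap scale F G X \<in> tensor2 scale"
  "flip scale X \<in> tensor2 scale" "coset_add (rel2 scale) X Y \<in> tensor2 scale"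
  "coset_scale (rel2 scale) c X \<in> tensor2 scale" "ad2 scale br x X \<in> tensor2 scale"
  by (auto simp: tensor2_def tmap_def flip_def coset_add_def coset_scale_def ad2_def)

context
  fixes a b :: "'b \<Rightarrow> 'a"
  assumes ab: "a \<in> dual scale" "b \<in> dual scale"
begin

text \<open>Both sides evaluate the same representative \<open>rep X\<close>; the maps on the two
  factors are absorbed into the forms as transposes.\<close>

lemma tpair_tmap: "tpair (tmap scale F G X) a b = tpair X (dual_map F a) (dual_map G b)"
proof -
  have "(\<lambda>i. free_eval (pair2 a b) (case i of (x, y) \<Rightarrow> gen (F x, G y)))
      = pair2 (dual_map F a) (dual_map G b)"
    by (auto simp: fun_eq_iff pair2_def dual_map_def)
  then show ?thesis
    by (simp add: tmap_def tpair_coset[OF ab] free_eval_free_ext tpair_eq_free_eval[of X])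
qed

lemma tpair_flip: "tpair (flip scale X) a b = tpair X b a"
proof -
  have "(\<lambda>i. free_eval (pair2 a b) (case i of (x, y) \<Rightarrow> gen (y, x))) = pair2 b a"
    by (auto simp: fun_eq_iff pair2_def)
  then show ?thesis
    by (simp add: flip_def tpair_coset[OF ab] free_eval_free_ext tpair_eq_free_eval[of X])
qed

lemma tpair_coset_add: "tpair (coset_add (rel2 scale) X Y) a b = tpair X a b + tpair Y a b"
  by (simp add: coset_add_def tpair_coset[OF ab] free_eval_add tpair_eq_free_eval[of X] tpair_eq_free_eval[of Y])

lemma tpair_coset_scale: "tpair (coset_scale (rel2 scale) c X) a b = c * tpair X a b"
  by (simp add: coset_scale_def tpair_coset[OF ab] free_eval_scale tpair_eq_free_eval[of X])

lemma tpair_ad2: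
  "tpair (ad2 scale br x X) a b = tpair X (dual_map (br x) a) b + tpair X a (dual_map (br x) b)"
  by (simp add: ad2_def tpair_coset_add tpair_tmap) (simp add: dual_map_def)

context
  fixes c :: "'b \<Rightarrow> 'a"
  assumes c: "c \<in> dual scale"
begin

lemma tpair3_coset_add:
  "tpair3 (coset_add (rel3 scale) X Y) a b c = tpair3 X a b c + tpair3 Y a b c"
  by (simp add: coset_add_def tpair3_coset[OF ab c] free_eval_add tpair3_def[of X] tpair3_def[of Y])

text \<open>The last factor moves to the front and so meets \<open>a\<close>. Iterating
  \<open>cyc\<close> thus rotates the forms, which turns the co-Jacobi sum into the three cyclic
  terms of the Jacobi identity.\<close>

lemma tpair3_cyc: "tpair3 (cyc scale X) a b c = tpair3 X b c a"
proof -
  have "(\<lambda>i. free_eval (pair3 a b c) (case i of (x, y, z) \<Rightarrow> gen (z, x, y))) = pair3 b c a"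
    by (auto simp: fun_eq_iff pair3_def)
  then show ?thesis
    by (simp add: cyc_def tpair3_coset[OF ab c] free_eval_free_ext tpair3_def[of X])
qed

text \<open>Pairing the last two legs first leaves the scalar function of \<open>y\<close> given by
  \<open>tpair (\<delta> y) b c\<close>. When \<open>\<delta>\<close> is dual to \<open>brD\<close>,
  this function is \<open>brD b c\<close>, and a nested bracket results.\<close>

lemma tpair3_id_tensor:
  "tpair3 (id_tensor scale \<delta> X) a b c = tpair X a (\<lambda>y. tpair (\<delta> y) b c)"
proof -
  have inner: "(\<lambda>i. pair3 a b c (x, i)) = (\<lambda>i. a x * pair2 b c i)" for x
    by (auto simp: fun_eq_iff pair2_def pair3_def)
  \<comment> \<open>Used to pull the factor \<open>a x\<close> of the first leg out of the inner
    evaluation.\<close>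
  have "free_eval (\<lambda>i. k * F i) f = k * free_eval F f" for k F and f :: "'b \<times> 'b \<Rightarrow>\<^sub>0 'a"
    by (simp add: free_eval_def sum_distrib_left mult.left_commute)
  then have "(\<lambda>i. free_eval (pair3 a b c)
        (case i of (x, y) \<Rightarrow> free_ext (\<lambda>(u, v). gen (x, u, v)) (rep (\<delta> y))))
      = pair2 a (\<lambda>y. tpair (\<delta> y) b c)"
    by (auto simp: fun_eq_iff pair2_def[of a] free_eval_free_ext inner tpair_eq_free_eval)
  then show ?thesis
    by (simp add: id_tensor_def tpair3_coset[OF ab c] free_eval_free_ext tpair_eq_free_eval[of X])
qed

end

end

end

section \<open>Bracket laws on a carrier\<close>

context
  fixes s :: "'k::field \<Rightarrow> 'v::ab_group_add \<Rightarrow> 'v" and V br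
  assumes lie: "lie_algebra s V br"
begin

lemma lie_closed: "x \<in> V \<Longrightarrow> y \<in> V \<Longrightarrow> br x y \<in> V"
  and lie_add_left: "x \<in> V \<Longrightarrow> y \<in> V \<Longrightarrow> z \<in> V \<Longrightarrow> br (x + y) z = br x z + br y z"
  and lie_add_right: "x \<in> V \<Longrightarrow> y \<in> V \<Longrightarrow> z \<in> V \<Longrightarrow> br x (y + z) = br x y + br x z"
  and lie_scale_left: "x \<in> V \<Longrightarrow> y \<in> V \<Longrightarrow> br (s k x) y = s k (br x y)"
  and lie_scale_right: "x \<in> V \<Longrightarrow> y \<in> V \<Longrightarrow> br x (s k y) = s k (br x y)"
  and lie_jacobi:
    "x \<in> V \<Longrightarrow> y \<in> V \<Longrightarrow> z \<in> V \<Longrightarrow> br x (br y z) + br y (br z x) + br z (br x y) = 0"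
  using lie unfolding lie_algebra_def linear_on_def by blast+

text \<open>Polarisation: expand the vanishing bracket of \<open>x + y\<close> with itself.\<close>

lemma lie_skew:
  assumes "x \<in> V" "y \<in> V"
  shows "br y x = - br x y"
proof -
  interpret vector_space s using lie by (simp add: lie_algebra_def)
  have "subspace V" using lie by (simp add: lie_algebra_def)
  then have xy: "x + y \<in> V" using assms by (simp add: subspace_add)
  then have "br (x + y) (x + y) = 0" "br x x = 0" "br y y = 0"
    using lie assms by (auto simp: lie_algebra_def)
  then have "br x y + br y x = 0"
    using assms xy by (simp add: lie_add_left lie_add_right add.commute)
  then show ?thesis by (simp add: eq_neg_iff_add_eq_0 add.commute)
qed

end

section \<open>Manin triples and the dual cobracket\<close>

locale manin_triple_cobracket = finite_dimensional_vector_space s Basis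
  for s :: "'k::field \<Rightarrow> 'a::ab_group_add \<Rightarrow> 'a" and Basis :: "'a set" +
  fixes brd :: "'a \<times> ('a \<Rightarrow> 'k) \<Rightarrow> 'a \<times> ('a \<Rightarrow> 'k) \<Rightarrow> 'a \<times> ('a \<Rightarrow> 'k)"
    and brA :: "'a \<Rightarrow> 'a \<Rightarrow> 'a"
    and brD :: "('a \<Rightarrow> 'k) \<Rightarrow> ('a \<Rightarrow> 'k) \<Rightarrow> 'a \<Rightarrow> 'k"
    and \<delta> :: "'a \<Rightarrow> ('a \<times> 'a \<Rightarrow>\<^sub>0 'k) set"
  assumes manin: "manin_triple s brd brA brD"
    and cobracket: "dual_cobracket s brD \<delta>"
begin

lemma lie_d: "lie_algebra (double_scale s) (double s) brd"
  and lie_A: "lie_algebra s UNIV brA"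
  and lie_D: "lie_algebra dual_scale (dual s) brD"
  using manin by (auto simp: manin_triple_def)

lemma brd_A: "brd (x, 0) (y, 0) = (brA x y, 0)"
  and brd_D: "a \<in> dual s \<Longrightarrow> b \<in> dual s \<Longrightarrow> brd (0, a) (0, b) = (0, brD a b)"
  and Bd_invariant:
    "u \<in> double s \<Longrightarrow> v \<in> double s \<Longrightarrow> w \<in> double s \<Longrightarrow> Bd (brd u v) w = Bd u (brd v w)"
  using manin by (auto simp: manin_triple_def)

lemma tensor2_cobracket [simp]: "\<delta> x \<in> tensor2 s"
  and tpair_cobracket: "a \<in> dual s \<Longrightarrow> b \<in> dual s \<Longrightarrow> tpair (\<delta> x) a b = brD a b x"
  using cobracket by (auto simp: dual_cobracket_def)

lemma dual_zero_mem [simp]: "0 \<in> dual s"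
  and dual_uminus_mem [simp]: "a \<in> dual s \<Longrightarrow> - a \<in> dual s"
  by (auto intro!: dualI[OF vector_space_axioms] simp: dualD algebra_simps)

lemma dual_map_mem [simp]:
  assumes "Vector_Spaces.linear s s F" "a \<in> dual s"
  shows "dual_map F a \<in> dual s"
proof -
  interpret F: Vector_Spaces.linear s s F by fact
  show ?thesis
    by (rule dualI[OF vector_space_axioms]) (simp_all add: dual_map_def F.add F.scale dualD[OF assms(2)])
qed

lemma double_mem [simp]: "(x, a) \<in> double s \<longleftrightarrow> a \<in> dual s"
  by (simp add: double_def)

lemma linear_brA [simp]: "Vector_Spaces.linear s s (brA x)"
  unfolding Vector_Spaces.linear_iff using vector_space_axioms lie_add_right[OF lie_A] lie_scale_right[OF lie_A]
  by auto

lemma brD_mem [simp]: "a \<in> dual s \<Longrightarrow> b \<in> dual s \<Longrightarrow> brD a b \<in> dual s"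
  by (rule lie_closed[OF lie_D])

lemma brD_uminus:
  assumes "a \<in> dual s" "b \<in> dual s"
  shows "brD (- a) b = - brD a b"
proof -
  have neg: "- f = dual_scale (-1) f" for f :: "'a \<Rightarrow> 'k"
    by (auto simp: dual_scale_def fun_eq_iff)
  show ?thesis unfolding neg by (rule lie_scale_left[OF lie_D assms])
qed

lemma brD_zero: "b \<in> dual s \<Longrightarrow> brD 0 b = 0" "b \<in> dual s \<Longrightarrow> brD b 0 = 0"
  using lie_add_left[OF lie_D, of 0 0 b] lie_add_right[OF lie_D, of b 0 0] by simp_all

text \<open>Up to sign, the coadjoint action of \<open>A*\<close> on \<open>A\<close>.\<close>

definition act :: "'a \<Rightarrow> ('a \<Rightarrow> 'k) \<Rightarrow> 'a" where
  "act x b = fst (brd (x, 0) (0, b))"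

text \<open>Pairing \<open>[x, b]\<close> with \<open>(0, a)\<close> isolates its component in
  \<open>A\<close>; invariance then moves the bracket onto \<open>b\<close> and \<open>a\<close>,
  where it is \<open>brD\<close>.\<close>

lemma dual_act:
  assumes "a \<in> dual s" "b \<in> dual s"
  shows "a (act x b) = brD b a x"
proof -
  \<comment> \<open>The pairing with \<open>(0, a)\<close> also contains the second component
    evaluated at 0, which vanishes because that component is a linear form.\<close>
  have "brd (x, 0) (0, b) \<in> double s" using assms by (intro lie_closed[OF lie_d]) auto
  then have "snd (brd (x, 0) (0, b)) \<in> dual s" by (auto simp: double_def)
  then have "a (act x b) = Bd (brd (x, 0) (0, b)) (0, a)" by (simp add: Bd_def act_def dual_zero)
  also have "\<dots> = brD b a x" using assms by (simp add: Bd_invariant brd_D) (simp add: Bd_def)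
  finally show ?thesis .
qed

text \<open>The component in the dual is read off by pairing with \<open>(y, 0)\<close>.
  Skew-symmetry first puts \<open>x\<close> next to \<open>y\<close>, so that invariance produces
  \<open>brA x y\<close>.\<close>

lemma brd_mixed:
  assumes "b \<in> dual s"
  shows "brd (x, 0) (0, b) = (act x b, - dual_map (brA x) b)"
proof -
  have "snd (brd (x, 0) (0, b)) y = - b (brA x y)" for y
  proof -
    have "snd (brd (x, 0) (0, b)) y = Bd (- brd (0, b) (x, 0)) (y, 0)"
      using assms by (simp add: lie_skew[OF lie_d, of "(0, b)"] Bd_def)
    also have "\<dots> = - Bd (brd (0, b) (x, 0)) (y, 0)" by (simp add: Bd_def)
    also have "\<dots> = - b (brA x y)" using assms by (simp add: Bd_invariant brd_A) (simp add: Bd_def)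
    finally show ?thesis .
  qed
  then show ?thesis by (auto simp: prod_eq_iff act_def dual_map_def fun_eq_iff)
qed

lemma brd_eq:
  assumes a: "a \<in> dual s" and b: "b \<in> dual s"
  shows "brd (x, a) (y, b)
    = (brA x y + act x b - act y a, brD a b - dual_map (brA x) b + dual_map (brA y) a)"
proof -
  have [simp]: "(y, 0) + (0, b) \<in> double s" using b by simp
  have "brd (x, a) (y, b) = brd ((x, 0) + (0, a)) ((y, 0) + (0, b))" by simp
  also have "\<dots> = brd (x, 0) (y, 0) + brd (x, 0) (0, b) + (brd (0, a) (y, 0) + brd (0, a) (0, b))"
    using a b by (simp add: lie_add_left[OF lie_d] lie_add_right[OF lie_d] del: add_Pair)
  also have "brd (0, a) (y, 0) = - brd (y, 0) (0, a)"
    using a by (intro lie_skew[OF lie_d]) auto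
  finally show ?thesis
    unfolding brd_A brd_D[OF a b] brd_mixed[OF a] brd_mixed[OF b] by (simp add: algebra_simps)
qed

lemma act_zero [simp]: "act x 0 = 0" "b \<in> dual s \<Longrightarrow> act 0 b = 0"
  by (rule dual_separates; simp add: dual_act brD_zero dual_zero dual_zero[OF brD_mem])+

lemma dual_map_zero [simp]: "dual_map F 0 = 0"
  by (auto simp: dual_map_def)

lemma dual_map_brA_zero [simp]: "b \<in> dual s \<Longrightarrow> dual_map (brA 0) b = 0"
  using lie_add_left[OF lie_A, of 0 0] by (auto simp: dual_map_def fun_eq_iff dual_zero)

lemma brA_zero [simp]: "brA 0 x = 0" "brA x 0 = 0"
  using lie_add_left[OF lie_A, of 0 0 x] lie_add_right[OF lie_A, of x 0 0] by simp_all

lemma brA_uminus: "brA x (- y) = - brA x y"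
  using lie_add_right[OF lie_A, of x y "- y"] by (simp add: eq_neg_iff_add_eq_0 add.commute)

text \<open>This is the cocycle condition of the bialgebra after pairing with \<open>a\<close> and
  \<open>b\<close>.\<close>

lemma brD_cocycle:
  assumes a: "a \<in> dual s" and b: "b \<in> dual s"
  shows "brD a b (brA x y) = brD (dual_map (brA x) a) b y + brD a (dual_map (brA x) b) y
    - (brD (dual_map (brA y) a) b x + brD a (dual_map (brA y) b) x)"
proof -
  \<comment> \<open>Only the component in \<open>A\<close> of the Jacobi identity is used. By
    \<open>dual_act\<close>, each of the two outer brackets with \<open>x\<close> or
    \<open>y\<close> yields two values of \<open>brD\<close>, and the bracket with \<open>a\<close>
    yields \<open>- brD a b (brA x y)\<close>.\<close>
  have "b (fst (brd (x, 0) (brd (y, 0) (0, a)) + brd (y, 0) (brd (0, a) (x, 0))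
      + brd (0, a) (brd (x, 0) (y, 0)))) = 0"
    using a b by (subst lie_jacobi[OF lie_d]) (auto simp: dual_zero)
  moreover have "b (brA z v) = dual_map (brA z) b v" for z v
    by (simp add: dual_map_def)
  ultimately show ?thesis
    using a b
    by (simp add: brd_eq brD_zero dualD[OF b] dual_act brD_uminus
        brA_uminus algebra_simps)
qed

text \<open>Every axiom is tested on linear forms: antisymmetry and co-Jacobi become skew-symmetry
  and Jacobi for \<open>brD\<close>, and compatibility becomes \<open>brD_cocycle\<close>.\<close>

lemma lie_bialgebra_cobracket: "lie_bialgebra s brA \<delta>"
proof -
  have "\<delta> (x + y) = coset_add (rel2 s) (\<delta> x) (\<delta> y)" for x y
    by (rule tensor2_eqI) (simp_all add: tpair_coset_add tpair_cobracket dual_add[OF brD_mem])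
  moreover have "\<delta> (s c x) = coset_scale (rel2 s) c (\<delta> x)" for c x
    by (rule tensor2_eqI)
      (simp_all add: tpair_coset_scale tpair_cobracket dual_scale_arg[OF brD_mem])
  moreover have "\<delta> x = coset_scale (rel2 s) (-1) (flip s (\<delta> x))" for x
  proof (rule tensor2_eqI)
    fix a b assume "a \<in> dual s" "b \<in> dual s"
    then show "tpair (\<delta> x) a b = tpair (coset_scale (rel2 s) (-1) (flip s (\<delta> x))) a b"
      using lie_skew[OF lie_D, of b a] by (simp add: tpair_coset_scale tpair_flip tpair_cobracket)
  qed simp_all
  moreover have "coset_add (rel3 s) (coset_add (rel3 s) X (cyc s X)) (cyc s (cyc s X)) = coset (rel3 s) 0"
    if X: "X = id_tensor s \<delta> (\<delta> x)" for X x
  proof -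
    let ?Y = "coset_add (rel3 s) X (cyc s X)" and ?Z = "cyc s (cyc s X)"
    have pairX: "tpair3 X a b c = brD a (brD b c) x"
      if "a \<in> dual s" "b \<in> dual s" "c \<in> dual s" for a b c
    proof -
      have "(\<lambda>y. tpair (\<delta> y) b c) = brD b c" using that by (simp add: tpair_cobracket)
      then show ?thesis using that by (simp add: X tpair3_id_tensor tpair_cobracket)
    qed
    \<comment> \<open>The outermost \<open>coset_add\<close> is by definition the coset of this sum
      of representatives, so it is the zero coset once all products of forms vanish on the
      sum.\<close>
    have "free_eval (pair3 a b c) (rep ?Y + rep ?Z) = 0"
      if abc: "a \<in> dual s" "b \<in> dual s" "c \<in> dual s" for a b c
    proof -
      have "free_eval (pair3 a b c) (rep ?Y + rep ?Z) = tpair3 ?Y a b c + tpair3 ?Z a b c"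
        by (simp add: free_eval_add tpair3_def)
      also have "\<dots> = (brD a (brD b c) + brD b (brD c a) + brD c (brD a b)) x"
        using abc by (simp add: tpair3_coset_add tpair3_cyc pairX)
      also have "\<dots> = 0"
        using abc by (subst lie_jacobi[OF lie_D]) auto
      finally show ?thesis .
    qed
    then show ?thesis by (simp add: coset_add_def[of _ ?Y] coset_rel3_eq_iff)
  qed
  moreover have "\<delta> (brA x y) = coset_add (rel2 s) (ad2 s brA x (\<delta> y))
      (coset_scale (rel2 s) (-1) (ad2 s brA y (\<delta> x)))" for x y
    by (rule tensor2_eqI)
      (simp_all add: tpair_coset_add tpair_coset_scale tpair_ad2 tpair_cobracket brD_cocycle)
  ultimately show ?thesis
    by (simp add: lie_bialgebra_def lie_coalgebra_def linear_to_tensor2_def Let_def lie_A)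
qed

text \<open>Converts the coalgebra equations of the claim into equations between brackets of
  transposed forms.\<close>

lemma tmap_cobracket_eq_iff:
  assumes "Vector_Spaces.linear s s F" "Vector_Spaces.linear s s G"
    and "Vector_Spaces.linear s s F'" "Vector_Spaces.linear s s G'"
  shows "tmap s F G (\<delta> x) = tmap s F' G' (\<delta> x') \<longleftrightarrow>
    (\<forall>a\<in>dual s. \<forall>b\<in>dual s. brD (dual_map F a) (dual_map G b) x = brD (dual_map F' a) (dual_map G' b) x')"
proof -
  have *: "tpair (tmap s F G (\<delta> x)) a b = brD (dual_map F a) (dual_map G b) x"
    if "Vector_Spaces.linear s s F" "Vector_Spaces.linear s s G" "a \<in> dual s" "b \<in> dual s" for F G a b x
    using that by (simp add: tpair_tmap tpair_cobracket)
  show ?thesis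
  proof
    assume "tmap s F G (\<delta> x) = tmap s F' G' (\<delta> x')"
    then show "\<forall>a\<in>dual s. \<forall>b\<in>dual s.
        brD (dual_map F a) (dual_map G b) x = brD (dual_map F' a) (dual_map G' b) x'"
      using * assms by metis
  qed (rule tensor2_eqI, use * assms in auto)
qed

lemma dual_map_id [simp]: "dual_map id a = a"
  by (simp add: dual_map_def)

lemma dual_eq_iff: "x = y \<longleftrightarrow> (\<forall>a\<in>dual s. a x = a y)"
  using dual_separates by blast

section \<open>Averaging operators on the double\<close>

context
  fixes P Q :: "'a \<Rightarrow> 'a"
  assumes P: "Vector_Spaces.linear s s P" and Q: "Vector_Spaces.linear s s Q"
begin

interpretation P: Vector_Spaces.linear s s P by (fact P)
interpretation Q: Vector_Spaces.linear s s Q by (fact Q)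

lemma linear_on_dual_map: "linear_on dual_scale (dual s) (dual_map Q)"
  using Q by (auto simp: linear_on_def dual_scale_def) (auto simp: dual_map_def)

lemma linear_on_double_map: "linear_on (double_scale s) (double s) (double_map P Q)"
  unfolding linear_on_def double_map_def double_def double_scale_def
  using Q by (auto simp: P.add P.scale dual_scale_def) (auto simp: dual_map_def)

text \<open>In the formula \<open>brd_eq\<close> for the bracket of general elements, each summand
  on the left matches one on the right under one of the six conditions. Conversely, setting two of
  the four arguments to zero isolates these summands.\<close>

lemma averaging_double_iff:
  "averaging_operator (double_scale s) (double s) brd (double_map P Q) \<longleftrightarrow>
    (\<forall>x y. brA (P x) (P y) = P (brA (P x) y)) \<and>
    (\<forall>a\<in>dual s. \<forall>b\<in>dual s. brD (dual_map Q a) (dual_map Q b) = dual_map Q (brD (dual_map Q a) b)) \<and>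
    (\<forall>x. \<forall>b\<in>dual s. act (P x) (dual_map Q b) = P (act (P x) b)) \<and>
    (\<forall>x. \<forall>b\<in>dual s. act (P x) (dual_map Q b) = P (act x (dual_map Q b))) \<and>
    (\<forall>x. \<forall>b\<in>dual s. dual_map (brA (P x)) (dual_map Q b) = dual_map Q (dual_map (brA (P x)) b)) \<and>
    (\<forall>x. \<forall>b\<in>dual s. dual_map (brA (P x)) (dual_map Q b) = dual_map Q (dual_map (brA x) (dual_map Q b)))"
  (is "?avg \<longleftrightarrow> ?comp")
proof -
  have avg: "?avg \<longleftrightarrow> (\<forall>x y. \<forall>a\<in>dual s. \<forall>b\<in>dual s.
      brd (P x, dual_map Q a) (P y, dual_map Q b) = double_map P Q (brd (P x, dual_map Q a) (y, b)))"
    using linear_on_double_map by (auto simp: averaging_operator_def double_def double_map_def)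
  have dual_map_simps: "dual_map Q (a + b) = dual_map Q a + dual_map Q b"
    "dual_map Q (a - b) = dual_map Q a - dual_map Q b"
    "dual_map Q (- a) = - dual_map Q a" for a b :: "'a \<Rightarrow> 'k"
    by (auto simp: dual_map_def)
  show ?thesis
  proof
    assume comp: ?comp
    show ?avg
      unfolding avg
    proof (intro allI ballI)
      fix x y a b assume a: "a \<in> dual s" and b: "b \<in> dual s"
      have "brA (P x) (P y) = P (brA (P x) y)"
        "brD (dual_map Q a) (dual_map Q b) = dual_map Q (brD (dual_map Q a) b)"
        "act (P x) (dual_map Q b) = P (act (P x) b)"
        "act (P y) (dual_map Q a) = P (act y (dual_map Q a))"
        "dual_map (brA (P x)) (dual_map Q b) = dual_map Q (dual_map (brA (P x)) b)"
        "dual_map (brA (P y)) (dual_map Q a) = dual_map Q (dual_map (brA y) (dual_map Q a))"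
        using comp a b by blast+
      then show "brd (P x, dual_map Q a) (P y, dual_map Q b)
          = double_map P Q (brd (P x, dual_map Q a) (y, b))"
        using a b Q by (simp add: brd_eq double_map_def P.add P.diff dual_map_simps)
    qed
  next
    assume ?avg
    then have *: "brd (P x, dual_map Q a) (P y, dual_map Q b)
        = double_map P Q (brd (P x, dual_map Q a) (y, b))"
      if "a \<in> dual s" "b \<in> dual s" for x y a b
      using avg that by blast
    show ?comp
    proof (intro conjI allI ballI)
      fix x y
      show "brA (P x) (P y) = P (brA (P x) y)"
        using *[of 0 0 x y] by (simp add: brd_A double_map_def)
    next
      fix a b assume "a \<in> dual s" "b \<in> dual s"
      then show "brD (dual_map Q a) (dual_map Q b) = dual_map Q (brD (dual_map Q a) b)"
        using *[of a b 0 0] Q by (simp add: brd_D double_map_def)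
    next
      fix x b assume b: "b \<in> dual s"
      \<comment> \<open>The first instance has its left argument in \<open>A\<close> and its right
        one in the dual; the second has them the other way round. They differ because the averaging
        identity treats its arguments asymmetrically: the operator is dropped from the right
        one.\<close>
      note 1 = *[OF dual_zero_mem b, of x 0] and 2 = *[OF b dual_zero_mem, of 0 x]
      show "act (P x) (dual_map Q b) = P (act (P x) b)"
        "dual_map (brA (P x)) (dual_map Q b) = dual_map Q (dual_map (brA (P x)) b)"
        using 1 b Q by (simp_all add: brd_mixed double_map_def dual_map_simps)
      show "act (P x) (dual_map Q b) = P (act x (dual_map Q b))"
        "dual_map (brA (P x)) (dual_map Q b) = dual_map Q (dual_map (brA x) (dual_map Q b))"
        using 2 b Q by (simp_all add: brd_eq brD_zero double_map_def dual_map_simps P.neg)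
    qed
  qed
qed

lemma averaging_manin_triple_iff:
  "averaging_manin_triple s brd brA brD P Q \<longleftrightarrow>
      (\<forall>x y.
        brA (P x) (P y) = P (brA (P x) y) \<and>
        brA (P x) (Q y) = Q (brA (P x) y) \<and> Q (brA (P x) y) = Q (brA x (Q y)) \<and>
        tmap s Q Q (\<delta> x) = tmap s Q id (\<delta> (Q x)) \<and>
        tmap s Q P (\<delta> x) = tmap s Q id (\<delta> (P x)) \<and>
        tmap s Q id (\<delta> (P x)) = tmap s id P (\<delta> (P x)))"
proof -
  have P_avg: "averaging_operator s UNIV brA P \<longleftrightarrow> (\<forall>x y. brA (P x) (P y) = P (brA (P x) y))"
    by (simp add: averaging_operator_def linear_on_def P.add P.scale)
  have Q_avg: "averaging_operator dual_scale (dual s) brD (dual_map Q) \<longleftrightarrow>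
      (\<forall>a\<in>dual s. \<forall>b\<in>dual s. brD (dual_map Q a) (dual_map Q b) = dual_map Q (brD (dual_map Q a) b))"
    by (simp add: averaging_operator_def linear_on_dual_map)
  \<comment> \<open>Evaluated at \<open>x\<close>, an outer \<open>dual_map Q\<close> shifts the
    argument to \<open>Q x\<close>, which is where \<open>\<delta> (Q x)\<close> comes from.\<close>
  have QQ: "(\<forall>a\<in>dual s. \<forall>b\<in>dual s. brD (dual_map Q a) (dual_map Q b) = dual_map Q (brD (dual_map Q a) b))
      \<longleftrightarrow> (\<forall>x. tmap s Q Q (\<delta> x) = tmap s Q id (\<delta> (Q x)))"
    using Q by (auto simp: tmap_cobracket_eq_iff linear_id fun_eq_iff dual_map_def[of Q "brD _ _"])
  have act_simps: "a (act x b) = brD b a x" "a (P (act x b)) = brD b (dual_map P a) x"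
    if "a \<in> dual s" "b \<in> dual s" for a b x
    using that dual_act[OF dual_map_mem[OF P], of a b x] by (simp_all add: dual_act dual_map_def[of P])
  \<comment> \<open>Tested against a form \<open>a\<close>, the two sides are
    \<open>brD (dual_map Q b) a\<close> and \<open>brD b (dual_map P a)\<close> at
    \<open>P x\<close>: the form \<open>b\<close> takes the first leg, so \<open>Q\<close> acts
    there and \<open>P\<close> on the second.\<close>
  have act1: "(\<forall>b\<in>dual s. act (P x) (dual_map Q b) = P (act (P x) b))
      \<longleftrightarrow> tmap s Q id (\<delta> (P x)) = tmap s id P (\<delta> (P x))" for x
    using P Q by (simp add: tmap_cobracket_eq_iff linear_id dual_eq_iff act_simps)
  have act2: "(\<forall>b\<in>dual s. act (P x) (dual_map Q b) = P (act x (dual_map Q b)))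
      \<longleftrightarrow> tmap s Q P (\<delta> x) = tmap s Q id (\<delta> (P x))" for x
    using P Q by (auto simp: tmap_cobracket_eq_iff linear_id dual_eq_iff act_simps)
  \<comment> \<open>Evaluated at \<open>y\<close>, both sides are values of the form
    \<open>b\<close>. Since forms separate points, \<open>b\<close> can be cancelled.\<close>
  have coad1: "(\<forall>b\<in>dual s. dual_map (brA (P x)) (dual_map Q b) = dual_map Q (dual_map (brA (P x)) b))
      \<longleftrightarrow> (\<forall>y. brA (P x) (Q y) = Q (brA (P x) y))" for x
    unfolding dual_eq_iff fun_eq_iff dual_map_def by metis
  have coad2: "(\<forall>b\<in>dual s. dual_map (brA (P x)) (dual_map Q b) = dual_map Q (dual_map (brA x) (dual_map Q b)))
      \<longleftrightarrow> (\<forall>y. Q (brA (P x) y) = Q (brA x (Q y)))" for x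
    by (auto simp: dual_eq_iff dual_map_def fun_eq_iff)
  show ?thesis
    unfolding averaging_manin_triple_def P_avg Q_avg averaging_double_iff act1 act2 coad1 coad2 QQ
    using manin P Q by blast
qed

end

end

theorem theorem4p16:
  fixes s :: "'k::{alg_closed_field, field_char_0} \<Rightarrow> 'a::ab_group_add \<Rightarrow> 'a"
    and Basis :: "'a set"
    and brd :: "'a \<times> ('a \<Rightarrow> 'k) \<Rightarrow> 'a \<times> ('a \<Rightarrow> 'k) \<Rightarrow> 'a \<times> ('a \<Rightarrow> 'k)"
    and brA :: "'a \<Rightarrow> 'a \<Rightarrow> 'a"
    and brD :: "('a \<Rightarrow> 'k) \<Rightarrow> ('a \<Rightarrow> 'k) \<Rightarrow> 'a \<Rightarrow> 'k"
    and \<delta> :: "'a \<Rightarrow> ('a \<times> 'a \<Rightarrow>\<^sub>0 'k) set"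
    and P Q :: "'a \<Rightarrow> 'a"
  assumes "finite_dimensional_vector_space s Basis"
    and "manin_triple s brd brA brD"
    and "dual_cobracket s brD \<delta>"
    and "Vector_Spaces.linear s s P"
    and "Vector_Spaces.linear s s Q"
  shows "(averaging_manin_triple s brd brA brD P Q \<longleftrightarrow>
      (\<forall>x y.
        brA (P x) (P y) = P (brA (P x) y) \<and>
        brA (P x) (Q y) = Q (brA (P x) y) \<and> Q (brA (P x) y) = Q (brA x (Q y)) \<and>
        tmap s Q Q (\<delta> x) = tmap s Q id (\<delta> (Q x)) \<and>
        tmap s Q P (\<delta> x) = tmap s Q id (\<delta> (P x)) \<and>
        tmap s Q id (\<delta> (P x)) = tmap s id P (\<delta> (P x)))) \<and>
    (averaging_manin_triple s brd brA brD P Q \<longleftrightarrow> averaging_lie_bialgebra s brA \<delta> P Q)"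
proof -
  interpret manin_triple_cobracket s Basis brd brA brD \<delta>
    using assms by (simp add: manin_triple_cobracket_def manin_triple_cobracket_axioms_def)
  show ?thesis
    \<comment> \<open>The bialgebra axioms in \<open>averaging_lie_bialgebra\<close> are supplied by
      the Manin triple, so the second equivalence reduces to the same equations as the
      first.\<close>
    unfolding averaging_manin_triple_iff[OF assms(4,5)] averaging_lie_bialgebra_def
    using lie_bialgebra_cobracket assms(4,5) by blast
qed

end
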